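(* Let $\mathcal{H}$ be a complex Hilbert space, let $A,B,C,D,S,T\in\mathcal{B}(\mathcal{H})$ and let $q\in[0,1]$. Then $$\omega_q(ATB+CSD)\le\frac12\left(\left\|A|T^*|^{2(1-\alpha)}A^*+C|S^*|^{2(1-\alpha)}C^*\right\|+\left\|B^*|T|^{2\alpha}B+D^*|S|^{2\alpha}D\right\|\right)$$ holds for all $\alpha\in[0,1]$.
   Context: $\mathcal{B}(\mathcal{H})$ denotes the bounded linear operators on the complex Hilbert space $\mathcal{H}$, $\|\cdot\|$ the operator norm, $T^*$ the adjoint of $T$, and $|T|=(T^*T)^{1/2}$ the absolute value of $T$. Nonnegative powers of positive operators are taken by functional calculus, with zeroth power equal to the identity. For $q\in[0,1]$, the $q$-numerical radius of $T$ is $\omega_q(T)=\sup\{|\langle Tx,y\rangle| : x,y\in\mathcal{H},\ \|x\|=\|y\|=1,\ \langle x,y\rangle=q\}$. The supremum over the empty set (which occurs only when $\dim\mathcal{H}=0$, or $\dim\mathcal{H}=1$ and $q<1$) is read as $0$. *)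

theory Defs
  imports "HOL-Analysis.Analysis" "HOL-Computational_Algebra.Polynomial"
begin

text \<open>Complex Hilbert spaces. The inner product is linear in the first argument; the
  norm, the topology and real scalar multiplication are those of the class \<^class>\<open>banach\<close>.\<close>

class complex_hilbert = banach +
  fixes scaleC :: "complex \<Rightarrow> 'a \<Rightarrow> 'a"  (infixr \<open>*\<^sub>C\<close> 75)
    and cinner :: "'a \<Rightarrow> 'a \<Rightarrow> complex"
  assumes scaleC_add_right: "c *\<^sub>C (x + y) = c *\<^sub>C x + c *\<^sub>C y"
    and scaleC_add_left: "(c + d) *\<^sub>C x = c *\<^sub>C x + d *\<^sub>C x"
    and scaleC_scaleC: "c *\<^sub>C (d *\<^sub>C x) = (c * d) *\<^sub>C x"
    and scaleC_one: "1 *\<^sub>C x = x"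
    and scaleR_scaleC: "r *\<^sub>R x = complex_of_real r *\<^sub>C x"
    and cinner_commute: "cinner x y = cnj (cinner y x)"
    and cinner_add_left: "cinner (x + y) z = cinner x z + cinner y z"
    and cinner_scaleC_left: "cinner (c *\<^sub>C x) y = c * cinner x y"
    and cinner_ge_zero: "0 \<le> Re (cinner x x)"
    and cinner_eq_zero_iff: "cinner x x = 0 \<longleftrightarrow> x = 0"
    and norm_eq_sqrt_cinner: "norm x = sqrt (Re (cinner x x))"

text \<open>The library type \<open>'a \<Rightarrow>\<^sub>L 'a\<close> consists of the bounded real-linear maps; the bounded
  operators on a complex Hilbert space are its elements satisfying the following predicate.
  Norm, sum and composition are those of the library type.\<close>

definition complex_linear :: "('a::complex_hilbert \<Rightarrow>\<^sub>L 'a) \<Rightarrow> bool" where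
  "complex_linear T \<longleftrightarrow> (\<forall>c x. blinfun_apply T (c *\<^sub>C x) = c *\<^sub>C blinfun_apply T x)"

definition op_adjoint :: "('a::complex_hilbert \<Rightarrow>\<^sub>L 'a) \<Rightarrow> ('a \<Rightarrow>\<^sub>L 'a)" where
  "op_adjoint T = (THE S. complex_linear S \<and>
     (\<forall>x y. cinner (blinfun_apply T x) y = cinner x (blinfun_apply S y)))"

definition op_spectrum :: "('a::complex_hilbert \<Rightarrow>\<^sub>L 'a) \<Rightarrow> complex set" where
  "op_spectrum T = {l. \<not> (\<exists>S. complex_linear S \<and>
     (\<forall>x. blinfun_apply S (blinfun_apply T x - l *\<^sub>C x) = x) \<and>
     (\<forall>x. blinfun_apply T (blinfun_apply S x) - l *\<^sub>C blinfun_apply S x = x))}"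

definition op_poly :: "real poly \<Rightarrow> ('a::complex_hilbert \<Rightarrow>\<^sub>L 'a) \<Rightarrow> ('a \<Rightarrow>\<^sub>L 'a)" where
  "op_poly p T = (\<Sum>i\<le>degree p. coeff p i *\<^sub>R (((o\<^sub>L) T) ^^ i) id_blinfun)"

text \<open>Continuous functional calculus of a self-adjoint operator \<open>T\<close>, whose spectrum is a
  compact set of reals: \<open>f(T)\<close> is the norm limit of \<open>p\<^sub>n(T)\<close> for any real polynomials \<open>p\<^sub>n\<close>
  converging to \<open>f\<close> uniformly on the spectrum. Such polynomials exist by Weierstrass'
  theorem when \<open>f\<close> is continuous on the spectrum. Not meaningful for other \<open>T\<close> and \<open>f\<close>.\<close>

definition op_fun :: "(real \<Rightarrow> real) \<Rightarrow> ('a::complex_hilbert \<Rightarrow>\<^sub>L 'a) \<Rightarrow> ('a \<Rightarrow>\<^sub>L 'a)" where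
  "op_fun f T = (THE S. \<forall>p :: nat \<Rightarrow> real poly.
     uniform_limit {t. complex_of_real t \<in> op_spectrum T} (\<lambda>n. poly (p n)) f sequentially
       \<longrightarrow> (\<lambda>n. op_poly (p n) T) \<longlonglongrightarrow> S)"

text \<open>Powers of positive operators with exponent \<open>s \<ge> 0\<close>. The case distinction is needed because
  \<^term>\<open>(0::real) powr 0\<close> is \<open>0\<close>, whereas the zeroth power is to be the identity.\<close>

definition op_powr :: "('a::complex_hilbert \<Rightarrow>\<^sub>L 'a) \<Rightarrow> real \<Rightarrow> ('a \<Rightarrow>\<^sub>L 'a)" where
  "op_powr T s = op_fun (\<lambda>t. if s = 0 then 1 else t powr s) T"

definition op_abs :: "('a::complex_hilbert \<Rightarrow>\<^sub>L 'a) \<Rightarrow> ('a \<Rightarrow>\<^sub>L 'a)" where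
  "op_abs T = op_powr (op_adjoint T o\<^sub>L T) (1/2)"

text \<open>The supremum of the empty set is read as \<open>0\<close>; \<^term>\<open>Sup {} :: real\<close> is unspecified.\<close>

definition q_numerical_radius :: "real \<Rightarrow> ('a::complex_hilbert \<Rightarrow>\<^sub>L 'a) \<Rightarrow> real" where
  "q_numerical_radius q T =
     (let V = {cmod (cinner (blinfun_apply T x) y) | x y.
                 norm x = 1 \<and> norm y = 1 \<and> cinner x y = complex_of_real q}
      in if V = {} then 0 else Sup V)"

end

theory Submission
  imports Defs "HOL-Computational_Algebra.Fundamental_Theorem_Algebra"
begin

text \<open>Let \<open>x\<close> and \<open>y\<close> be unit vectors. Then
\<open>\<langle>(ATB + CSD) x, y\<rangle> = \<langle>T Bx, A\<^sup>*y\<rangle> + \<langle>S Dx, C\<^sup>*y\<rangle>\<close>. Kato's mixed Schwarz inequality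
(lemma \<open>mixed_Schwarz\<close>), in the form obtained from the arithmetic-geometric mean inequality,
says that \<open>2 Re \<langle>Tu, v\<rangle>\<close> is at most the quadratic form of \<open>|T|\<close> to the power \<open>2\<alpha>\<close> at \<open>u\<close> plus
that of \<open>|T\<^sup>*|\<close> to the power \<open>2(1-\<alpha>)\<close> at \<open>v\<close>. It bounds twice the real part of each summand.
Moving \<open>A\<close>, \<open>B\<close>, \<open>C\<close> and \<open>D\<close> to the other side of the inner products collects the terms in \<open>x\<close> and the terms in \<open>y\<close> into the quadratic forms of the two
operators whose norms appear in the bound. A rotation of \<open>y\<close> by a phase passes from the real part
to the modulus.

The mixed Schwarz inequality is derived from the continuous functional calculus of \<open>|T|\<close> and
\<open>|T\<^sup>*|\<close> and from \<open>T h(|T|) = h(|T\<^sup>*|) T\<close>, without a polar decomposition. The definition of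
\<open>op_fun\<close> asks for convergence on the spectrum only, so it has a meaning once
\<open>\<parallel>p(A)\<parallel> \<le> sup \<bar>p\<bar>\<close>, with the supremum over the spectrum of the self-adjoint operator \<open>A\<close>
(lemma \<open>norm_op_poly_le\<close>). The argument for this uses only real polynomials in \<open>A\<close>. In a nonzero
space \<open>p(A)\<^sup>2 - \<parallel>p(A)\<parallel>\<^sup>2\<close> is not bounded below. Hence, unless \<open>p\<^sup>2\<close> is constant, one of the real
factors of \<open>p\<^sup>2 - \<parallel>p(A)\<parallel>\<^sup>2\<close> gives an operator that is not bounded below, and this can only be a
factor \<open>x - t\<close> with \<open>t\<close> in the spectrum.

Almost everything takes place in the real inner product \<open>rinner x y = Re (cinner x y)\<close>, which
determines the complex one.\<close>

section \<open>The real inner product\<close>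

definition rinner :: "'a::complex_hilbert \<Rightarrow> 'a \<Rightarrow> real" where
  "rinner x y = Re (cinner x y)"

lemma rinner_self: "rinner x x = (norm x)\<^sup>2"
  by (simp add: rinner_def norm_eq_sqrt_cinner cinner_ge_zero)

lemma rinner_commute: "rinner x y = rinner y x"
  unfolding rinner_def by (subst cinner_commute) simp

lemma rinner_add_left: "rinner (x + y) z = rinner x z + rinner y z"
  by (simp add: rinner_def cinner_add_left)

lemma rinner_scaleR_left: "rinner (r *\<^sub>R x) z = r * rinner x z"
  by (simp add: rinner_def scaleR_scaleC cinner_scaleC_left)

lemma rinner_add_right: "rinner z (x + y) = rinner z x + rinner z y"
  by (metis rinner_add_left rinner_commute)

lemma rinner_scaleR_right: "rinner z (r *\<^sub>R x) = r * rinner z x"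
  by (metis rinner_scaleR_left rinner_commute)

lemma rinner_le_norm_mult: "rinner x y \<le> norm x * norm y"
proof -
  have "(norm (x + y))\<^sup>2 \<le> (norm x + norm y)\<^sup>2"
    by (intro power_mono norm_triangle_ineq) simp
  then have "rinner (x + y) (x + y) \<le> rinner x x + 2 * (norm x * norm y) + rinner y y"
    by (simp add: rinner_self power2_sum)
  then show ?thesis
    using rinner_commute[of x y] by (simp add: rinner_add_left rinner_add_right)
qed

lemma bounded_bilinear_rinner: "bounded_bilinear rinner"
proof
  have "norm (rinner x y) \<le> norm x * norm y * 1" for x y :: 'a
    using rinner_le_norm_mult[of x y] rinner_le_norm_mult[of "(-1) *\<^sub>R x" y]
    by (simp only: rinner_scaleR_left real_norm_def) simp
  then show "\<exists>K. \<forall>x y :: 'a. norm (rinner x y) \<le> norm x * norm y * K"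
    by blast
qed (simp_all add: rinner_add_left rinner_add_right rinner_scaleR_left rinner_scaleR_right)

interpretation rinner: bounded_bilinear rinner
  by (rule bounded_bilinear_rinner)

lemma norm_add_sq: "(norm (x + y))\<^sup>2 = (norm x)\<^sup>2 + 2 * rinner x y + (norm y)\<^sup>2"
  for x y :: "'a::complex_hilbert"
  unfolding rinner_self[symmetric] using rinner_commute[of x y]
  by (simp add: rinner.add_left rinner.add_right)

lemma norm_diff_sq: "(norm (x - y))\<^sup>2 = (norm x)\<^sup>2 - 2 * rinner x y + (norm y)\<^sup>2"
  for x y :: "'a::complex_hilbert"
  unfolding rinner_self[symmetric] using rinner_commute[of x y]
  by (simp add: rinner.diff_left rinner.diff_right)

lemma rinner_eqI:
  assumes "\<And>x. rinner x y = rinner x z"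
  shows "y = z"
proof -
  have "rinner (y - z) (y - z) = 0"
    using assms by (simp add: rinner.diff_right)
  then show ?thesis by (simp add: rinner_self)
qed

lemma cinner_scaleC_right: "cinner x (c *\<^sub>C y) = cnj c * cinner x y"
  by (metis cinner_commute cinner_scaleC_left complex_cnj_mult)

lemma cinner_eq_rinner: "cinner x y = Complex (rinner x y) (rinner ((- \<i>) *\<^sub>C x) y)"
  by (simp add: rinner_def cinner_scaleC_left complex_eq_iff)

lemma norm_scaleC: "norm (c *\<^sub>C x) = cmod c * norm x"
proof -
  have "cinner (c *\<^sub>C x) (c *\<^sub>C x) = complex_of_real ((cmod c)\<^sup>2) * cinner x x"
    unfolding complex_norm_square by (simp add: cinner_scaleC_left cinner_scaleC_right)
  then have "(norm (c *\<^sub>C x))\<^sup>2 = (cmod c * norm x)\<^sup>2"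
    unfolding rinner_self[symmetric] power_mult_distrib by (simp add: rinner_def)
  then show ?thesis by (simp add: power2_eq_iff_nonneg)
qed

lemma bounded_linear_scaleC: "bounded_linear (\<lambda>x::'a::complex_hilbert. c *\<^sub>C x)"
proof
  show "\<exists>K. \<forall>x::'a. norm (c *\<^sub>C x) \<le> norm x * K"
    by (rule exI[of _ "cmod c"]) (simp add: norm_scaleC mult.commute)
qed (simp_all add: scaleC_add_right scaleR_scaleC scaleC_scaleC mult.commute)

section \<open>Riesz representation and adjoints\<close>

text \<open>Riesz representation. The representing vector is the minimiser of
\<open>J x = \<parallel>x\<parallel>\<^sup>2 - 2 f x\<close>. The parallelogram law makes every minimising sequence Cauchy, and
the derivative of \<open>J\<close> in direction \<open>h\<close>, which vanishes at the minimum, is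
\<open>2 (rinner h z - f h)\<close>.\<close>

lemma riesz:
  fixes f :: "'a::complex_hilbert \<Rightarrow> real"
  assumes "bounded_linear f"
  shows "\<exists>z. \<forall>x. f x = rinner x z"
proof -
  interpret f: bounded_linear f by fact
  define J where "J x = (norm x)\<^sup>2 - 2 * f x" for x
  obtain K where K: "\<And>x. norm (f x) \<le> norm x * K"
    using f.bounded by blast
  have lower: "- K\<^sup>2 \<le> J x" for x
  proof -
    have "0 \<le> (norm x - K)\<^sup>2" by simp
    then show ?thesis using K[of x] unfolding J_def power2_diff by (simp add: abs_le_iff)
  qed
  define m where "m = Inf (range J)"
  have bdd: "bdd_below (range J)" using lower by (intro bdd_belowI[of _ "- K\<^sup>2"]) auto
  have m_le: "m \<le> J x" for x
    unfolding m_def by (rule cInf_lower) (use bdd in auto)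
  have "\<exists>x. J x < m + inverse (real (Suc n))" for n
  proof -
    have "m < m + inverse (real (Suc n))" by simp
    then show ?thesis unfolding m_def by (subst (asm) (1) cInf_less_iff) (use bdd in auto)
  qed
  then obtain X where X: "\<And>n. J (X n) < m + inverse (real (Suc n))" by metis
  have parallelogram: "(norm (x - y))\<^sup>2 \<le> 2 * (J x - m) + 2 * (J y - m)" for x y
  proof -
    have n: "norm ((1/2) *\<^sub>R (x + y)) = norm (x + y) / 2"
      by (simp del: scaleR_add_right)
    have "J ((1/2) *\<^sub>R (x + y)) = (norm (x + y) / 2)\<^sup>2 - (f x + f y)"
      unfolding J_def f.scaleR f.add n by (simp add: field_simps)
    then have "4 * J ((1/2) *\<^sub>R (x + y)) = (norm (x + y))\<^sup>2 - 4 * f x - 4 * f y"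
      by (simp add: power_divide)
    also have "\<dots> = 2 * J x + 2 * J y - (norm (x - y))\<^sup>2"
      by (simp add: J_def norm_add_sq norm_diff_sq)
    finally show ?thesis using m_le[of "(1/2) *\<^sub>R (x + y)"] by simp
  qed
  have "Cauchy X"
  proof (rule CauchyI)
    fix e :: real assume "0 < e"
    then obtain N where N: "inverse (real (Suc N)) < e\<^sup>2 / 4"
      using reals_Archimedean[of "e\<^sup>2 / 4"] by auto
    have "norm (X i - X j) < e" if "N \<le> i" "N \<le> j" for i j
    proof -
      have close: "J (X k) - m < e\<^sup>2 / 4" if "N \<le> k" for k
      proof -
        have "inverse (real (Suc k)) \<le> inverse (real (Suc N))"
          using that by (intro le_imp_inverse_le) auto
        then show ?thesis using X[of k] N by linarith
      qed
      have "2 * (J (X i) - m) + 2 * (J (X j) - m) < e\<^sup>2"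
        using close[OF that(1)] close[OF that(2)] by (simp add: field_simps)
      then have "(norm (X i - X j))\<^sup>2 < e\<^sup>2"
        by (rule le_less_trans[OF parallelogram])
      then show ?thesis using \<open>0 < e\<close> by (simp add: power_less_imp_less_base)
    qed
    then show "\<exists>M. \<forall>i\<ge>M. \<forall>j\<ge>M. norm (X i - X j) < e" by blast
  qed
  then obtain z where z: "X \<longlonglongrightarrow> z" by (meson Cauchy_convergent convergent_def)
  have "(\<lambda>n. J (X n)) \<longlonglongrightarrow> J z"
    unfolding J_def by (intro tendsto_intros f.tendsto z)
  moreover have "(\<lambda>n. m + inverse (real (Suc n))) \<longlonglongrightarrow> m + 0"
    by (intro tendsto_intros LIMSEQ_inverse_real_of_nat)
  ultimately have "J z \<le> m + 0"
    by (rule LIMSEQ_le) (use X less_imp_le in blast)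
  have "f h = rinner h z" for h
  proof -
    define d where "d = rinner h z - f h"
    define a where "a = (norm h)\<^sup>2"
    have a: "0 \<le> a" by (simp add: a_def)
    have variation: "0 \<le> t\<^sup>2 * a + 2 * t * d" for t
    proof -
      have "J (z + t *\<^sub>R h) = J z + (t\<^sup>2 * a + 2 * t * d)"
        by (simp add: J_def a_def d_def norm_add_sq f.add f.scaleR rinner_scaleR_right
            rinner_commute[of z h] power_mult_distrib algebra_simps)
      then show ?thesis using m_le[of "z + t *\<^sub>R h"] \<open>J z \<le> m + 0\<close> by simp
    qed
    define s where "s = 1 / (a + 1)"
    have "0 < s" "s * a < 1" using a by (simp_all add: s_def)
    then have "s * (s * a - 2) < 0" by (intro mult_pos_neg) auto
    moreover have "0 \<le> s * (s * a - 2) * d\<^sup>2"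
      using variation[of "- s * d"] by (simp add: power2_eq_square algebra_simps)
    ultimately have "d\<^sup>2 \<le> 0" by (metis mult_neg_pos not_le)
    then have "d = 0" by simp
    then show ?thesis by (simp add: d_def)
  qed
  then show ?thesis by blast
qed

text \<open>Riesz representation gives the adjoint for the real inner product only. Complex linearity of
\<open>T\<close> upgrades the identity to the complex inner product, because the imaginary part of
\<open>cinner x y\<close> is the real inner product of \<open>-\<i>x\<close> and \<open>y\<close>.\<close>

lemma ex_adjoint:
  fixes T :: "'a::complex_hilbert \<Rightarrow>\<^sub>L 'a"
  assumes "complex_linear T"
  shows "\<exists>S. complex_linear S \<and> (\<forall>x y. cinner (blinfun_apply T x) y = cinner x (blinfun_apply S y))"
proof -
  have "\<exists>z. \<forall>x. rinner (blinfun_apply T x) y = rinner x z" for y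
    by (rule riesz) (intro bounded_linear_compose[OF rinner.bounded_linear_left blinfun.bounded_linear_right])
  then obtain S0 where S0: "\<And>x y. rinner (blinfun_apply T x) y = rinner x (S0 y)" by metis
  have cS0: "cinner (blinfun_apply T x) y = cinner x (S0 y)" for x y
    using assms by (simp add: cinner_eq_rinner S0[symmetric] complex_linear_def)
  have "bounded_linear S0"
  proof (rule bounded_linear_intro)
    show "S0 (x + y) = S0 x + S0 y" for x y
      by (rule rinner_eqI) (simp add: rinner_add_right S0[symmetric])
    show "S0 (r *\<^sub>R x) = r *\<^sub>R S0 x" for r x
      by (rule rinner_eqI) (simp add: rinner_scaleR_right S0[symmetric])
    show "norm (S0 y) \<le> norm y * norm T" for y
    proof -
      have "(norm (S0 y))\<^sup>2 \<le> norm (blinfun_apply T (S0 y)) * norm y"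
        unfolding rinner_self[symmetric] S0[symmetric] by (rule rinner_le_norm_mult)
      also have "\<dots> \<le> norm T * norm (S0 y) * norm y"
        by (intro mult_right_mono norm_blinfun) simp
      finally show ?thesis
        by (cases "norm (S0 y) = 0") (simp_all add: power2_eq_square mult_ac)
    qed
  qed
  then have app: "blinfun_apply (Blinfun S0) = S0" by (rule bounded_linear_Blinfun_apply)
  have "S0 (c *\<^sub>C y) = c *\<^sub>C S0 y" for c y
  proof (rule rinner_eqI)
    fix x
    show "rinner x (S0 (c *\<^sub>C y)) = rinner x (c *\<^sub>C S0 y)"
      by (simp only: rinner_def cS0[symmetric] cinner_scaleC_right)
  qed
  then show ?thesis
    using cS0 by (intro exI[of _ "Blinfun S0"]) (simp add: app complex_linear_def)
qed

lemma adjoint_exists_unique: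
  fixes T :: "'a::complex_hilbert \<Rightarrow>\<^sub>L 'a"
  assumes "complex_linear T"
  shows "\<exists>!S. complex_linear S \<and> (\<forall>x y. cinner (blinfun_apply T x) y = cinner x (blinfun_apply S y))"
proof (rule ex_ex1I[OF ex_adjoint[OF assms]])
  fix R S
  assume "complex_linear R \<and> (\<forall>x y. cinner (blinfun_apply T x) y = cinner x (blinfun_apply R y))"
    and "complex_linear S \<and> (\<forall>x y. cinner (blinfun_apply T x) y = cinner x (blinfun_apply S y))"
  then show "R = S"
    by (intro blinfun_eqI rinner_eqI) (simp add: rinner_def)
qed

lemma complex_linear_adjoint: "complex_linear T \<Longrightarrow> complex_linear (op_adjoint T)"
  using theI'[OF adjoint_exists_unique] unfolding op_adjoint_def by blast

lemma cinner_adjoint: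
  "complex_linear T \<Longrightarrow> cinner (blinfun_apply T x) y = cinner x (blinfun_apply (op_adjoint T) y)"
  using theI'[OF adjoint_exists_unique] unfolding op_adjoint_def by blast

lemma rinner_adjoint:
  "complex_linear T \<Longrightarrow> rinner (blinfun_apply T x) y = rinner x (blinfun_apply (op_adjoint T) y)"
  by (simp add: rinner_def cinner_adjoint)

lemma adjoint_adjoint:
  assumes "complex_linear T" shows "op_adjoint (op_adjoint T) = T"
proof (intro blinfun_eqI rinner_eqI)
  fix x y
  show "rinner x (blinfun_apply (op_adjoint (op_adjoint T)) y) = rinner x (blinfun_apply T y)"
    by (metis assms complex_linear_adjoint rinner_adjoint rinner_commute)
qed

section \<open>Polynomials of an operator\<close>

lemma blinfun_compose_assoc: "(F o\<^sub>L G) o\<^sub>L H = F o\<^sub>L (G o\<^sub>L H)"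
  by (rule blinfun_eqI) simp

lemma blinfun_compose_id: "F o\<^sub>L id_blinfun = F" "id_blinfun o\<^sub>L F = F"
  by (rule blinfun_eqI, simp)+

lemmas compose_simps = blinfun_compose_id
  bounded_bilinear.add_left[OF bounded_bilinear_blinfun_compose]
  bounded_bilinear.add_right[OF bounded_bilinear_blinfun_compose]
  bounded_bilinear.scaleR_left[OF bounded_bilinear_blinfun_compose]
  bounded_bilinear.scaleR_right[OF bounded_bilinear_blinfun_compose]
  bounded_bilinear.zero_left[OF bounded_bilinear_blinfun_compose]
  bounded_bilinear.zero_right[OF bounded_bilinear_blinfun_compose]

lemma op_poly_0: "op_poly 0 A = 0"
  by (simp add: op_poly_def)

text \<open>Horner's rule. Together with induction on polynomials it yields all algebraic properties of
\<open>op_poly\<close> without reference to degrees.\<close>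

lemma op_poly_pCons: "op_poly (pCons a p) A = a *\<^sub>R id_blinfun + (A o\<^sub>L op_poly p A)"
proof (cases "p = 0")
  case False
  then show ?thesis
    by (simp add: op_poly_def sum.atMost_Suc_shift del: sum.atMost_Suc
        add: bounded_bilinear.sum_right[OF bounded_bilinear_blinfun_compose] compose_simps)
qed (simp add: op_poly_def compose_simps)

lemma op_poly_1: "op_poly 1 A = id_blinfun"
  by (simp add: op_poly_def)

lemma op_poly_add: "op_poly (p + q) A = op_poly p A + op_poly q A"
  by (induction p q rule: poly_induct2)
    (simp_all add: op_poly_0 op_poly_pCons scaleR_add_left compose_simps)

lemma op_poly_smult: "op_poly (smult c p) A = c *\<^sub>R op_poly p A"
  by (induction p) (simp_all add: op_poly_0 op_poly_pCons scaleR_add_right compose_simps)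

lemma op_poly_diff: "op_poly (p - q) A = op_poly p A - op_poly q A"
  using op_poly_add[of "p - q" q A] by simp

lemma op_poly_mult: "op_poly (p * q) A = op_poly p A o\<^sub>L op_poly q A"
  by (induction p) (simp_all add: op_poly_0 op_poly_pCons op_poly_add op_poly_smult
      compose_simps blinfun_compose_assoc)

lemma op_poly_intertwine:
  assumes "T o\<^sub>L A = B o\<^sub>L T"
  shows "T o\<^sub>L op_poly p A = op_poly p B o\<^sub>L T"
proof (induction p)
  case (pCons a p)
  have "T o\<^sub>L (A o\<^sub>L op_poly p A) = B o\<^sub>L (op_poly p B o\<^sub>L T)"
    by (metis assms blinfun_compose_assoc pCons.IH)
  then show ?case by (simp add: op_poly_pCons compose_simps blinfun_compose_assoc)
qed (simp add: op_poly_0 compose_simps)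

text \<open>For complex linear operators, symmetry with respect to the real inner product is equivalent to
symmetry with respect to the complex one.\<close>

definition self_adjoint :: "('a::complex_hilbert \<Rightarrow>\<^sub>L 'a) \<Rightarrow> bool" where
  "self_adjoint A \<longleftrightarrow> complex_linear A \<and>
     (\<forall>x y. rinner (blinfun_apply A x) y = rinner x (blinfun_apply A y))"

lemma rinner_self_adjoint:
  "self_adjoint A \<Longrightarrow> rinner (blinfun_apply A x) y = rinner x (blinfun_apply A y)"
  by (simp add: self_adjoint_def)

lemma complex_linear_compose:
  "complex_linear A \<Longrightarrow> complex_linear B \<Longrightarrow> complex_linear (A o\<^sub>L B)"
  by (simp add: complex_linear_def)

lemma self_adjoint_op_poly:
  assumes "self_adjoint A"
  shows "self_adjoint (op_poly p A)"
proof (induction p)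
  case 0
  have "(0::'a) = c *\<^sub>C 0" for c
    by (metis linear_simps(3) bounded_linear_scaleC)
  then show ?case by (simp add: op_poly_0 self_adjoint_def complex_linear_def rinner.zero_left rinner.zero_right)
next
  case (pCons a p)
  have "complex_linear (op_poly (pCons a p) A)"
    using pCons.IH assms
    by (simp add: op_poly_pCons self_adjoint_def complex_linear_def blinfun.add_left blinfun.scaleR_left
        scaleC_add_right scaleR_scaleC scaleC_scaleC mult.commute)
  moreover have "blinfun_apply A (blinfun_apply (op_poly p A) x)
      = blinfun_apply (op_poly p A) (blinfun_apply A x)" for x
    using op_poly_intertwine[of A A A p] by (metis blinfun_apply_blinfun_compose)
  ultimately show ?case
    using pCons.IH assms
    by (simp add: op_poly_pCons self_adjoint_def blinfun.add_left blinfun.scaleR_left rinner.add_left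
        rinner.add_right rinner.scaleR_left rinner.scaleR_right)
qed

section \<open>Spectral bounds\<close>

definition bounded_below :: "('a::real_normed_vector \<Rightarrow>\<^sub>L 'b::real_normed_vector) \<Rightarrow> bool" where
  "bounded_below G \<longleftrightarrow> (\<exists>d>0. \<forall>x. d * norm x \<le> norm (blinfun_apply G x))"

lemma bounded_below_compose:
  assumes "bounded_below F" "bounded_below G"
  shows "bounded_below (F o\<^sub>L G)"
proof -
  obtain d e where "0 < d" "0 < e"
    and d: "\<And>x. d * norm x \<le> norm (blinfun_apply F x)"
    and e: "\<And>x. e * norm x \<le> norm (blinfun_apply G x)"
    using assms unfolding bounded_below_def by auto
  have "(d * e) * norm x \<le> norm (blinfun_apply (F o\<^sub>L G) x)" for x
  proof -
    have "(d * e) * norm x \<le> d * norm (blinfun_apply G x)"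
      using e[of x] \<open>0 < d\<close> by (simp add: mult.assoc)
    also have "\<dots> \<le> norm (blinfun_apply F (blinfun_apply G x))" by (rule d)
    finally show ?thesis by simp
  qed
  then show ?thesis using \<open>0 < d\<close> \<open>0 < e\<close> unfolding bounded_below_def by (metis mult_pos_pos)
qed

definition coercive :: "('a::complex_hilbert \<Rightarrow>\<^sub>L 'a) \<Rightarrow> bool" where
  "coercive G \<longleftrightarrow> (\<exists>d>0. \<forall>x. d * (norm x)\<^sup>2 \<le> rinner (blinfun_apply G x) x)"

lemma coercive_imp_bounded_below: "coercive G \<Longrightarrow> bounded_below G"
proof -
  assume "coercive G"
  then obtain d where "0 < d" and d: "\<And>x. d * (norm x)\<^sup>2 \<le> rinner (blinfun_apply G x) x"
    unfolding coercive_def by auto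
  have "d * norm x \<le> norm (blinfun_apply G x)" for x
    using order_trans[OF d[of x] rinner_le_norm_mult]
    by (cases "norm x = 0") (simp_all add: power2_eq_square)
  then show ?thesis using \<open>0 < d\<close> unfolding bounded_below_def by blast
qed

abbreviation real_spectrum :: "('a::complex_hilbert \<Rightarrow>\<^sub>L 'a) \<Rightarrow> real set" where
  "real_spectrum A \<equiv> {t. complex_of_real t \<in> op_spectrum A}"

lemma not_in_spectrum_imp_bounded_below:
  assumes "t \<notin> real_spectrum A"
  shows "bounded_below (op_poly [:-t, 1:] A)"
proof -
  obtain S where S: "\<And>x. blinfun_apply S (blinfun_apply A x - complex_of_real t *\<^sub>C x) = x"
    using assms unfolding op_spectrum_def by auto
  have pos: "0 < norm S + 1" by (simp add: add_nonneg_pos)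
  have "inverse (norm S + 1) * norm x \<le> norm (blinfun_apply (op_poly [:-t, 1:] A) x)" for x
  proof -
    have "norm x = norm (blinfun_apply S (blinfun_apply (op_poly [:-t, 1:] A) x))"
      using S[of x] by (simp add: op_poly_pCons op_poly_0 compose_simps blinfun.add_left blinfun.scaleR_left
          scaleR_scaleC[symmetric] blinfun.minus_left blinfun.bilinear_simps)
    also have "\<dots> \<le> norm S * norm (blinfun_apply (op_poly [:-t, 1:] A) x)" by (rule norm_blinfun)
    also have "\<dots> \<le> (norm S + 1) * norm (blinfun_apply (op_poly [:-t, 1:] A) x)"
      by (intro mult_right_mono) auto
    finally show ?thesis
      using pos by (simp add: field_simps)
  qed
  moreover have "0 < inverse (norm S + 1)" using pos by simp
  ultimately show ?thesis unfolding bounded_below_def by blast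
qed

text \<open>Lax--Milgram. For small \<open>\<tau> > 0\<close> the map \<open>x \<mapsto> x - \<tau> (G x - y)\<close> is a contraction, because
\<open>\<parallel>x - \<tau> G x\<parallel>\<^sup>2 \<le> (1 - 2 \<tau> d + \<tau>\<^sup>2 \<parallel>G\<parallel>\<^sup>2) \<parallel>x\<parallel>\<^sup>2\<close>; its fixed point solves \<open>G x = y\<close>.\<close>

lemma coercive_imp_invertible:
  fixes G :: "'a::complex_hilbert \<Rightarrow>\<^sub>L 'a"
  assumes "complex_linear G" "coercive G"
  shows "\<exists>S. complex_linear S \<and> (\<forall>x. blinfun_apply S (blinfun_apply G x) = x) \<and>
     (\<forall>x. blinfun_apply G (blinfun_apply S x) = x)"
proof -
  obtain d where "0 < d" and d: "\<And>x. d * (norm x)\<^sup>2 \<le> rinner (blinfun_apply G x) x"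
    using assms(2) unfolding coercive_def by auto
  obtain e where "0 < e" and e: "\<And>x. e * norm x \<le> norm (blinfun_apply G x)"
    using coercive_imp_bounded_below[OF assms(2)] unfolding bounded_below_def by auto
  have surj: "\<exists>x. blinfun_apply G x = y" for y
  proof -
    \<comment> \<open>The summand \<open>d\<^sup>2\<close> makes the squared contraction constant \<open>1 - d\<^sup>2 / k\<close> nonnegative.\<close>
    define k where "k = d\<^sup>2 + (norm G)\<^sup>2"
    define \<tau> where "\<tau> = d / k"
    have k: "0 < k" "d\<^sup>2 \<le> k" "(norm G)\<^sup>2 \<le> k" using \<open>0 < d\<close> by (simp_all add: k_def add_pos_nonneg)
    then have \<tau>: "0 < \<tau>" using \<open>0 < d\<close> by (simp add: \<tau>_def)
    define f where "f x = x - \<tau> *\<^sub>R (blinfun_apply G x - y)" for x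
    define c where "c = sqrt (1 - d\<^sup>2 / k)"
    have sq: "(norm (x - \<tau> *\<^sub>R blinfun_apply G x))\<^sup>2 \<le> (c * norm x)\<^sup>2" for x
    proof -
      have "(norm (blinfun_apply G x))\<^sup>2 \<le> (norm G * norm x)\<^sup>2"
        by (intro power_mono norm_blinfun) simp
      also have "\<dots> \<le> k * (norm x)\<^sup>2"
        unfolding power_mult_distrib using k by (intro mult_right_mono) auto
      finally have "\<tau>\<^sup>2 * (norm (blinfun_apply G x))\<^sup>2 \<le> \<tau>\<^sup>2 * (k * (norm x)\<^sup>2)"
        by (intro mult_left_mono) auto
      moreover have "2 * \<tau> * (d * (norm x)\<^sup>2) \<le> 2 * \<tau> * rinner (blinfun_apply G x) x"
        using d[of x] \<tau> by (intro mult_left_mono) auto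
      ultimately have "(norm (x - \<tau> *\<^sub>R blinfun_apply G x))\<^sup>2
          \<le> (norm x)\<^sup>2 - 2 * \<tau> * (d * (norm x)\<^sup>2) + \<tau>\<^sup>2 * (k * (norm x)\<^sup>2)"
        by (simp add: norm_diff_sq rinner_scaleR_right power_mult_distrib
            rinner_commute[of x "blinfun_apply G x"])
      also have "\<dots> = (1 - d\<^sup>2 / k) * (norm x)\<^sup>2"
        using k(1) by (simp add: \<tau>_def field_simps power2_eq_square)
      also have "\<dots> = (c * norm x)\<^sup>2"
        using k unfolding c_def power_mult_distrib by simp
      finally show ?thesis .
    qed
    have c: "0 \<le> c" "c < 1" using k \<open>0 < d\<close> by (simp_all add: c_def)
    have "dist (f u) (f v) \<le> c * dist u v" for u v
    proof -
      have "f u - f v = (u - v) - \<tau> *\<^sub>R blinfun_apply G (u - v)"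
        by (simp add: f_def blinfun.diff_right algebra_simps)
      then show ?thesis
        unfolding dist_norm using power2_le_imp_le[OF sq[of "u - v"]] c by simp
    qed
    then have "\<exists>!x. f x = x"
      by (intro banach_fix_type[OF c]) blast
    then obtain x where "f x = x" by auto
    then show ?thesis using \<tau> by (auto simp: f_def)
  qed
  then obtain g where g: "\<And>y. blinfun_apply G (g y) = y" by metis
  have inj: "x = y" if "blinfun_apply G x = blinfun_apply G y" for x y
    using e[of "x - y"] that \<open>0 < e\<close> by (simp add: blinfun.diff_right mult_le_0_iff)
  have "bounded_linear g"
  proof (rule bounded_linear_intro)
    show "g (x + y) = g x + g y" for x y by (rule inj) (simp add: g blinfun.add_right)
    show "g (r *\<^sub>R x) = r *\<^sub>R g x" for r x by (rule inj) (simp add: g blinfun.scaleR_right)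
    show "norm (g x) \<le> norm x * inverse e" for x
      using e[of "g x"] \<open>0 < e\<close> by (simp add: g field_simps)
  qed
  then have app: "blinfun_apply (Blinfun g) = g" by (rule bounded_linear_Blinfun_apply)
  have "g (c *\<^sub>C x) = c *\<^sub>C g x" for c x
    by (rule inj) (use assms(1) in \<open>simp add: g complex_linear_def\<close>)
  moreover have "g (blinfun_apply G x) = x" for x by (rule inj) (simp add: g)
  ultimately show ?thesis
    by (intro exI[of _ "Blinfun g"]) (simp add: app g complex_linear_def)
qed

definition positive_op :: "('a::complex_hilbert \<Rightarrow>\<^sub>L 'a) \<Rightarrow> bool" where
  "positive_op A \<longleftrightarrow> self_adjoint A \<and> (\<forall>x. 0 \<le> rinner (blinfun_apply A x) x)"

text \<open>For \<open>t < 0\<close> the operator \<open>A - t\<close> is coercive, and for \<open>t > \<parallel>A\<parallel>\<close> its negative is; so both are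
invertible.\<close>

lemma positive_imp_spectrum_subset:
  assumes "positive_op A"
  shows "real_spectrum A \<subseteq> {0..norm A}"
proof
  fix t assume t: "t \<in> real_spectrum A"
  have sa: "self_adjoint A" and pos: "\<And>x. 0 \<le> rinner (blinfun_apply A x) x"
    using assms by (auto simp: positive_op_def)
  define G where "G = op_poly [:-t, 1:] A"
  have G: "blinfun_apply G x = blinfun_apply A x - complex_of_real t *\<^sub>C x" for x
    by (simp add: G_def op_poly_pCons op_poly_0 compose_simps blinfun.bilinear_simps
        scaleR_scaleC[symmetric])
  have G': "blinfun_apply G x = blinfun_apply A x - t *\<^sub>R x" for x
    by (simp add: G scaleR_scaleC)
  have clG: "complex_linear (r *\<^sub>R G)" for r
    using self_adjoint_op_poly[OF sa, of "smult r [:-t, 1:]"]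
    by (simp only: op_poly_smult G_def self_adjoint_def)
  have contra: False if co: "coercive (r *\<^sub>R G)" for r
  proof -
    obtain S where S: "complex_linear S" "\<And>x. blinfun_apply S (blinfun_apply (r *\<^sub>R G) x) = x"
      "\<And>x. blinfun_apply (r *\<^sub>R G) (blinfun_apply S x) = x"
      using coercive_imp_invertible[OF clG co] by blast
    have "complex_linear (r *\<^sub>R S)"
      using S(1) by (simp add: complex_linear_def blinfun.scaleR_left scaleR_scaleC scaleC_scaleC mult.commute)
    moreover have "blinfun_apply (r *\<^sub>R S) (blinfun_apply G x) = x" for x
      using S(2)[of x] by (simp add: blinfun.bilinear_simps)
    moreover have "blinfun_apply G (blinfun_apply (r *\<^sub>R S) x) = x" for x
      using S(3)[of x] by (simp add: blinfun.bilinear_simps)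
    ultimately show False using t unfolding op_spectrum_def G by blast
  qed
  have "0 \<le> t"
  proof (rule ccontr)
    assume "\<not> 0 \<le> t"
    then have "coercive (1 *\<^sub>R G)"
      unfolding coercive_def
      by (intro exI[of _ "- t"]) (simp add: G' rinner.diff_left rinner_scaleR_left rinner_self pos)
    then show False by (rule contra)
  qed
  moreover have "t \<le> norm A"
  proof (rule ccontr)
    assume t: "\<not> t \<le> norm A"
    have "rinner (blinfun_apply A x) x \<le> norm A * (norm x)\<^sup>2" for x
      using order_trans[OF rinner_le_norm_mult mult_right_mono[OF norm_blinfun norm_ge_zero]]
      by (fastforce simp: power2_eq_square mult.assoc)
    then have "coercive ((-1) *\<^sub>R G)"
      using t unfolding coercive_def
      by (intro exI[of _ "t - norm A"]) (simp add: G' rinner.diff_left rinner_scaleR_left rinner_self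
          blinfun.bilinear_simps rinner.minus_left algebra_simps)
    then show False by (rule contra)
  qed
  ultimately show "t \<in> {0..norm A}" by simp
qed

lemma poly_complex_of_real_add:
  "poly (map_poly complex_of_real (p + q)) z = poly (map_poly complex_of_real p) z + poly (map_poly complex_of_real q) z"
  by (induction p q rule: poly_induct2) (simp_all add: map_poly_pCons algebra_simps)

lemma poly_complex_of_real_smult:
  "poly (map_poly complex_of_real (smult c p)) z = complex_of_real c * poly (map_poly complex_of_real p) z"
  by (induction p) (simp_all add: map_poly_pCons algebra_simps)

lemma poly_complex_of_real_mult:
  "poly (map_poly complex_of_real (p * q)) z = poly (map_poly complex_of_real p) z * poly (map_poly complex_of_real q) z"
  by (induction p) (simp_all add: map_poly_pCons poly_complex_of_real_add poly_complex_of_real_smult algebra_simps)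

text \<open>The quadratic factor is written as \<open>(x - a)\<^sup>2 + b\<^sup>2\<close> because this form is visibly coercive when
\<open>x\<close> is replaced by a self-adjoint operator. It divides \<open>p\<close> because the remainder is a real
polynomial of degree at most one with a nonreal root.\<close>

lemma real_poly_factor:
  fixes p :: "real poly"
  assumes "0 < degree p"
  obtains (linear) t s where "p = [:-t, 1:] * s"
  | (quadratic) a b s where "b \<noteq> 0" "p = ([:-a, 1:] * [:-a, 1:] + [:b\<^sup>2:]) * s"
proof -
  have "degree (map_poly complex_of_real p) = degree p"
    by (rule degree_map_poly) simp
  then have "\<not> constant (poly (map_poly complex_of_real p))"
    using assms by (simp add: constant_degree)
  then obtain z where z: "poly (map_poly complex_of_real p) z = 0"
    using fundamental_theorem_of_algebra by blast
  show thesis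
  proof (cases "Im z = 0")
    case True
    then have "z = complex_of_real (Re z)" by (simp add: complex_eq_iff)
    moreover have "poly (map_poly complex_of_real p) (complex_of_real t) = complex_of_real (poly p t)" for t
      by (induction p) (simp_all add: map_poly_pCons)
    ultimately have "poly p (Re z) = 0" using z by (metis of_real_eq_0_iff)
    then show ?thesis using linear unfolding poly_eq_0_iff_dvd dvd_def by blast
  next
    case False
    define q where "q = [:- Re z, 1:] * [:- Re z, 1:] + [:(Im z)\<^sup>2:]"
    have qz: "poly (map_poly complex_of_real q) z = 0"
      by (simp add: q_def map_poly_pCons complex_eq_iff power2_eq_square algebra_simps)
    have deg: "degree q = 2" by (simp add: q_def)
    then have "degree (p mod q) \<le> 1"
      using degree_mod_less[of q p] by fastforce
    then obtain c d where cd: "p mod q = [:c, d:]"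
      by (metis One_nat_def degree_eq_zeroE degree_pCons_eq_if le_SucE le_zero_eq not_less_eq_eq
          pCons_cases Suc_inject pCons_0_0)
    have "poly (map_poly complex_of_real (p div q * q + p mod q)) z = 0" by (simp add: z)
    then have "poly (map_poly complex_of_real (p mod q)) z = 0"
      by (simp only: poly_complex_of_real_add poly_complex_of_real_mult qz mult_zero_right add_0_left)
    then have "p mod q = 0"
      using False unfolding cd by (auto simp: map_poly_pCons complex_eq_iff)
    then have "p = q * (p div q)" by (metis add.right_neutral div_mult_mod_eq mult.commute)
    then show ?thesis using quadratic[OF False, of "Re z"] unfolding q_def by blast
  qed
qed

text \<open>Split \<open>p\<close> into real factors. A factor \<open>x - t\<close> with \<open>t\<close> outside the spectrum becomes an
invertible operator, and an irreducible quadratic factor becomes a coercive one.\<close>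

lemma bounded_below_op_poly:
  assumes sa: "self_adjoint A" and "p \<noteq> 0" and "\<And>t. t \<in> real_spectrum A \<Longrightarrow> poly p t \<noteq> 0"
  shows "bounded_below (op_poly p A)"
  using assms(2,3)
proof (induction "degree p" arbitrary: p rule: less_induct)
  case less
  show ?case
  proof (cases "degree p = 0")
    case True
    then obtain c where "p = [:c:]" by (rule degree_eq_zeroE)
    then show ?thesis using \<open>p \<noteq> 0\<close>
      unfolding bounded_below_def
      by (intro exI[of _ "\<bar>c\<bar>"]) (simp add: op_poly_pCons op_poly_0 compose_simps blinfun.bilinear_simps)
  next
    case False
    then have "0 < degree p" by simp
    then show ?thesis
    proof (cases rule: real_poly_factor)
      case (linear t s)
      then have "s \<noteq> 0" using less.prems by auto
      then have "degree p = degree s + 1" unfolding linear by (subst degree_mult_eq) auto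
      then have "bounded_below (op_poly s A)"
        using \<open>s \<noteq> 0\<close> less.prems(2) by (intro less.hyps) (auto simp: linear)
      moreover have "t \<notin> real_spectrum A" using less.prems(2)[of t] by (auto simp: linear)
      ultimately show ?thesis
        unfolding linear op_poly_mult
        by (intro bounded_below_compose not_in_spectrum_imp_bounded_below)
    next
      case (quadratic a b s)
      define q where "q = [:-a, 1:] * [:-a, 1:] + [:b\<^sup>2:]"
      have p: "p = q * s" using quadratic by (simp only: q_def)
      have "degree q = 2" by (simp add: q_def)
      moreover from this have "q \<noteq> 0" by auto
      moreover have "s \<noteq> 0" using less.prems p by auto
      ultimately have "degree p = degree s + 2" unfolding p by (subst degree_mult_eq) auto
      then have s: "bounded_below (op_poly s A)"
        using \<open>s \<noteq> 0\<close> less.prems(2) by (intro less.hyps) (auto simp: p)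
      have "b\<^sup>2 * (norm x)\<^sup>2 \<le> rinner (blinfun_apply (op_poly q A) x) x" for x
      proof -
        define B where "B = op_poly [:-a, 1:] A"
        have "op_poly q A = (B o\<^sub>L B) + b\<^sup>2 *\<^sub>R id_blinfun"
          unfolding q_def op_poly_add op_poly_mult B_def[symmetric]
          by (simp add: op_poly_pCons op_poly_0 compose_simps)
        moreover have "rinner (blinfun_apply B (blinfun_apply B x)) x = (norm (blinfun_apply B x))\<^sup>2"
          using rinner_self_adjoint[OF self_adjoint_op_poly[OF sa]] by (simp add: B_def rinner_self)
        ultimately show ?thesis
          by (simp add: blinfun.bilinear_simps rinner.add_left rinner_scaleR_left rinner_self)
      qed
      then have "coercive (op_poly q A)"
        using quadratic(1) unfolding coercive_def by (intro exI[of _ "b\<^sup>2"]) simp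
      then show ?thesis
        unfolding p op_poly_mult by (intro bounded_below_compose coercive_imp_bounded_below s)
    qed
  qed
qed

text \<open>The number \<open>\<parallel>G\<parallel>\<^sup>2\<close> is an approximate eigenvalue of \<open>G\<^sup>2\<close>: with \<open>m = \<parallel>G\<parallel>\<close>, a lower bound
\<open>d \<parallel>x\<parallel> \<le> \<parallel>G\<^sup>2 x - m\<^sup>2 x\<parallel>\<close> would imply \<open>m\<^sup>2 \<parallel>G x\<parallel>\<^sup>2 \<le> (m\<^sup>4 - d\<^sup>2) \<parallel>x\<parallel>\<^sup>2\<close>, which makes the
norm of \<open>G\<close> smaller than \<open>m\<close>.\<close>

lemma not_bounded_below_norm_sq:
  fixes G :: "'a::complex_hilbert \<Rightarrow>\<^sub>L 'a"
  assumes sa: "self_adjoint G" and "x\<^sub>0 \<noteq> (0::'a)"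
  shows "\<not> bounded_below ((G o\<^sub>L G) - (norm G)\<^sup>2 *\<^sub>R id_blinfun)"
proof
  define m where "m = norm G"
  assume "bounded_below ((G o\<^sub>L G) - (norm G)\<^sup>2 *\<^sub>R id_blinfun)"
  then obtain d where "0 < d"
    and d: "\<And>x. d * norm x \<le> norm (blinfun_apply G (blinfun_apply G x) - m\<^sup>2 *\<^sub>R x)"
    unfolding bounded_below_def m_def by (auto simp: blinfun.bilinear_simps)
  have key: "m\<^sup>2 * (norm (blinfun_apply G x))\<^sup>2 \<le> (m\<^sup>2 * m\<^sup>2 - d\<^sup>2) * (norm x)\<^sup>2" for x
  proof -
    have "(d * norm x)\<^sup>2 \<le> (norm (blinfun_apply G (blinfun_apply G x) - m\<^sup>2 *\<^sub>R x))\<^sup>2"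
      using \<open>0 < d\<close> by (intro power_mono d) simp
    also have "\<dots> = (norm (blinfun_apply G (blinfun_apply G x)))\<^sup>2
        - 2 * m\<^sup>2 * (norm (blinfun_apply G x))\<^sup>2 + m\<^sup>2 * m\<^sup>2 * (norm x)\<^sup>2"
    proof -
      have "rinner (blinfun_apply G (blinfun_apply G x)) x = (norm (blinfun_apply G x))\<^sup>2"
        using rinner_self_adjoint[OF sa] by (simp add: rinner_self)
      moreover have "(norm (m\<^sup>2 *\<^sub>R x))\<^sup>2 = m\<^sup>2 * m\<^sup>2 * (norm x)\<^sup>2"
        by (simp add: power2_eq_square)
      ultimately show ?thesis by (simp add: norm_diff_sq rinner_scaleR_right)
    qed
    also have "(norm (blinfun_apply G (blinfun_apply G x)))\<^sup>2 \<le> (m * norm (blinfun_apply G x))\<^sup>2"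
      unfolding m_def by (intro power_mono norm_blinfun) simp
    finally show ?thesis by (simp add: power_mult_distrib algebra_simps)
  qed
  have "0 \<le> (m\<^sup>2 * m\<^sup>2 - d\<^sup>2) * (norm x\<^sub>0)\<^sup>2" by (rule order_trans[OF _ key]) simp
  then have nn: "0 \<le> m\<^sup>2 * m\<^sup>2 - d\<^sup>2" using assms(2) by (simp add: zero_le_mult_iff)
  then have "m \<noteq> 0" using \<open>0 < d\<close> by auto
  then have "0 < m" by (simp add: m_def)
  define c where "c = sqrt (m\<^sup>2 - d\<^sup>2 / m\<^sup>2)"
  have c_nn: "0 \<le> m\<^sup>2 - d\<^sup>2 / m\<^sup>2" using nn \<open>0 < m\<close> by (simp add: field_simps)
  have "norm (blinfun_apply G x) \<le> c * norm x" for x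
  proof (rule power2_le_imp_le)
    show "(norm (blinfun_apply G x))\<^sup>2 \<le> (c * norm x)\<^sup>2"
      using key[of x] \<open>0 < m\<close> c_nn by (simp add: c_def power_mult_distrib field_simps)
    show "0 \<le> c * norm x" using c_nn by (simp add: c_def)
  qed
  then have "m \<le> c" unfolding m_def using c_nn by (intro norm_blinfun_bound) (auto simp: c_def)
  then have "m\<^sup>2 \<le> c\<^sup>2" using \<open>0 < m\<close> by (intro power_mono) auto
  then show False using c_nn \<open>0 < d\<close> \<open>0 < m\<close> by (simp add: c_def divide_le_0_iff)
qed

text \<open>The norm of \<open>p(A)\<close> is attained as a value of \<open>\<bar>p\<bar>\<close> on the spectrum, since the polynomial
\<open>p\<^sup>2 - \<parallel>p(A)\<parallel>\<^sup>2\<close> must have a root there by the two preceding lemmas. The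
identically vanishing polynomial has to be excluded: it has roots everywhere, whether or not the
spectrum is empty.\<close>

lemma spectrum_meets_roots:
  fixes A :: "'a::complex_hilbert \<Rightarrow>\<^sub>L 'a"
  assumes sa: "self_adjoint A" and "x\<^sub>0 \<noteq> (0::'a)"
    and "p * p \<noteq> [:(norm (op_poly p A))\<^sup>2:]"
  shows "\<exists>t\<in>real_spectrum A. (poly p t)\<^sup>2 = (norm (op_poly p A))\<^sup>2"
proof (rule ccontr)
  define m where "m = norm (op_poly p A)"
  assume "\<not> ?thesis"
  then have "bounded_below (op_poly (p * p - [:m\<^sup>2:]) A)"
    using assms(3) by (intro bounded_below_op_poly[OF sa]) (auto simp: m_def power2_eq_square)
  moreover have "op_poly (p * p - [:m\<^sup>2:]) A = (op_poly p A o\<^sub>L op_poly p A) - m\<^sup>2 *\<^sub>R id_blinfun"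
    by (simp add: op_poly_diff op_poly_mult op_poly_pCons op_poly_0 compose_simps)
  ultimately show False
    using not_bounded_below_norm_sq[OF self_adjoint_op_poly[OF sa] assms(2)] by (simp add: m_def)
qed

text \<open>This estimate makes the functional calculus well defined: uniform convergence of polynomials on
the spectrum alone forces norm convergence of the operators. In the zero space the spectrum is
empty, and the bound comes from \<open>0 \<le> c\<close>.\<close>

lemma norm_op_poly_le:
  fixes A :: "'a::complex_hilbert \<Rightarrow>\<^sub>L 'a"
  assumes sa: "self_adjoint A" and "0 \<le> c" and c: "\<And>t. t \<in> real_spectrum A \<Longrightarrow> \<bar>poly p t\<bar> \<le> c"
  shows "norm (op_poly p A) \<le> c"
proof (cases "\<exists>x::'a. x \<noteq> 0")
  case False
  then have "blinfun_apply (op_poly p A) x = 0" for x by blast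
  then have "norm (blinfun_apply (op_poly p A) x) \<le> c * norm x" for x using \<open>0 \<le> c\<close> by simp
  then show ?thesis using \<open>0 \<le> c\<close> by (intro norm_blinfun_bound) auto
next
  case True
  then obtain x\<^sub>0 :: 'a where "x\<^sub>0 \<noteq> 0" by blast
  have "\<exists>t\<in>real_spectrum A. (poly p t)\<^sup>2 = (norm (op_poly p A))\<^sup>2"
  proof (cases "p * p = [:(norm (op_poly p A))\<^sup>2:]")
    case True
    \<comment> \<open>Here \<open>p\<^sup>2\<close> is constant, so any point of the spectrum will do; the polynomial \<open>x\<close> provides one.\<close>
    have "\<exists>t. t \<in> real_spectrum A"
      using spectrum_meets_roots[OF sa \<open>x\<^sub>0 \<noteq> 0\<close>, of "[:0, 1:]"] by auto
    moreover have "(poly p t)\<^sup>2 = (norm (op_poly p A))\<^sup>2" for t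
      using arg_cong[OF True, of "\<lambda>q. poly q t"] by (simp add: power2_eq_square)
    ultimately show ?thesis by blast
  qed (rule spectrum_meets_roots[OF sa \<open>x\<^sub>0 \<noteq> 0\<close>])
  then show ?thesis using c by (metis abs_norm_cancel power2_eq_iff abs_minus_cancel abs_le_iff)
qed

section \<open>Functional calculus of positive operators\<close>

lemma poly_uniform_approximation:
  fixes f :: "real \<Rightarrow> real"
  assumes "continuous_on {0..} f"
  obtains p :: "nat \<Rightarrow> real poly" where "uniform_limit {0..b} (\<lambda>n. poly (p n)) f sequentially"
proof -
  have "continuous_on {0..b} f" by (rule continuous_on_subset[OF assms]) auto
  then obtain g where g: "uniform_limit {0..b} g f sequentially" "\<And>n. polynomial_function (g n)"
    using Stone_Weierstrass_uniform_limit[of "{0..b}" f] by auto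
  have "\<exists>p. g n = poly p" for n
  proof -
    obtain a m where "g n = (\<lambda>x. \<Sum>i\<le>m. a i * x ^ i)"
      using g(2)[of n] by (auto simp: real_polynomial_function_eq[symmetric] real_polynomial_function_iff_sum)
    then have "g n = poly (\<Sum>i\<le>m. monom (a i) i)"
      by (simp add: fun_eq_iff poly_sum poly_monom)
    then show ?thesis by blast
  qed
  then obtain p where "\<And>n. g n = poly (p n)" by metis
  then have "g = (\<lambda>n. poly (p n))" by blast
  with g(1) that show thesis by blast
qed

text \<open>The form in which the spectral estimate enters, with \<open>p\<close> and \<open>q\<close> both approximating \<open>f\<close>:
equal sequences give the Cauchy property, different ones the independence of the limit.\<close>

lemma norm_op_poly_diff_le:
  assumes "self_adjoint A"
    and p: "\<And>t. t \<in> real_spectrum A \<Longrightarrow> dist (poly p t) (f t) < e / 3"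
    and q: "\<And>t. t \<in> real_spectrum A \<Longrightarrow> dist (poly q t) (f t) < e / 3" and "0 < e"
  shows "norm (op_poly p A - op_poly q A) < e"
proof -
  have "norm (op_poly (p - q) A) \<le> 2 * e / 3"
  proof (rule norm_op_poly_le)
    fix t assume "t \<in> real_spectrum A"
    from p[OF this] q[OF this] show "\<bar>poly (p - q) t\<bar> \<le> 2 * e / 3"
      unfolding dist_real_def poly_diff by linarith
  qed (use assms in auto)
  then show ?thesis using \<open>0 < e\<close> by (simp add: op_poly_diff)
qed

text \<open>The Weierstrass theorem provides one approximating sequence, whose operators converge; all
other sequences have the same limit, which is therefore the unique operator singled out by the
definition of \<open>op_fun\<close>.\<close>

lemma op_fun_tendsto:
  assumes pos: "positive_op A" and f: "continuous_on {0..} f"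
    and p: "uniform_limit (real_spectrum A) (\<lambda>n. poly (p n)) f sequentially"
  shows "(\<lambda>n. op_poly (p n) A) \<longlonglongrightarrow> op_fun f A"
proof -
  have sa: "self_adjoint A" using pos by (simp add: positive_op_def)
  obtain q :: "nat \<Rightarrow> real poly" where "uniform_limit {0..norm A} (\<lambda>n. poly (q n)) f sequentially"
    using poly_uniform_approximation[OF f] .
  then have q: "uniform_limit (real_spectrum A) (\<lambda>n. poly (q n)) f sequentially"
    by (rule uniform_limit_on_subset) (rule positive_imp_spectrum_subset[OF pos])
  have near: "\<forall>\<^sub>F n in sequentially. \<forall>t\<in>real_spectrum A. dist (poly (r n) t) (f t) < e / 3"
    if "uniform_limit (real_spectrum A) (\<lambda>n. poly (r n)) f sequentially" "0 < e" for r e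
    using uniform_limitD[OF that(1), of "e / 3"] that(2) by simp
  have "Cauchy (\<lambda>n. op_poly (q n) A)"
  proof (rule CauchyI)
    fix e :: real assume "0 < e"
    then obtain N where "\<And>n. N \<le> n \<Longrightarrow> \<forall>t\<in>real_spectrum A. dist (poly (q n) t) (f t) < e / 3"
      using near[OF q] by (auto simp: eventually_sequentially)
    then show "\<exists>M. \<forall>i\<ge>M. \<forall>j\<ge>M. norm (op_poly (q i) A - op_poly (q j) A) < e"
      using \<open>0 < e\<close> by (intro exI[of _ N] allI impI norm_op_poly_diff_le[OF sa, of _ f]) auto
  qed
  then obtain L where L: "(\<lambda>n. op_poly (q n) A) \<longlonglongrightarrow> L"
    by (meson Cauchy_convergent convergent_def)
  have lim: "(\<lambda>n. op_poly (r n) A) \<longlonglongrightarrow> L"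
    if r: "uniform_limit (real_spectrum A) (\<lambda>n. poly (r n)) f sequentially" for r
  proof -
    have "(\<lambda>n. op_poly (r n) A - op_poly (q n) A) \<longlonglongrightarrow> 0"
    proof (rule tendstoI)
      fix e :: real assume "0 < e"
      show "\<forall>\<^sub>F n in sequentially. dist (op_poly (r n) A - op_poly (q n) A) 0 < e"
        using near[OF r \<open>0 < e\<close>] near[OF q \<open>0 < e\<close>]
      proof eventually_elim
        case (elim n)
        show ?case
          unfolding dist_norm diff_zero
          by (rule norm_op_poly_diff_le[OF sa, of _ f]) (use elim \<open>0 < e\<close> in auto)
      qed
    qed
    from tendsto_add[OF this L] show ?thesis by simp
  qed
  have "op_fun f A = L"
    unfolding op_fun_def
  proof (rule the_equality)
    fix S
    assume "\<forall>p::nat \<Rightarrow> real poly. uniform_limit (real_spectrum A) (\<lambda>n. poly (p n)) f sequentially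
       \<longrightarrow> (\<lambda>n. op_poly (p n) A) \<longlonglongrightarrow> S"
    then have "(\<lambda>n. op_poly (q n) A) \<longlonglongrightarrow> S" using q by blast
    then show "S = L" using L by (rule LIMSEQ_unique)
  qed (use lim in blast)
  then show ?thesis using lim[OF p] by simp
qed

text \<open>One polynomial sequence serves all positive operators of norm at most \<open>b\<close> simultaneously, which
is needed to compare functions of different operators.\<close>

lemma op_fun_tendsto_interval:
  assumes "positive_op A" "continuous_on {0..} f" "norm A \<le> b"
    and "uniform_limit {0..b} (\<lambda>n. poly (p n)) f sequentially"
  shows "(\<lambda>n. op_poly (p n) A) \<longlonglongrightarrow> op_fun f A"
  using assms positive_imp_spectrum_subset[OF assms(1)]
  by (intro op_fun_tendsto uniform_limit_on_subset[OF assms(4)]) auto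

lemma op_fun_poly:
  assumes "positive_op A"
  shows "op_fun (poly p) A = op_poly p A"
proof (rule LIMSEQ_unique)
  show "(\<lambda>_. op_poly p A) \<longlonglongrightarrow> op_fun (poly p) A"
    by (intro op_fun_tendsto assms continuous_on_poly continuous_on_id uniform_limit_const)
qed (rule tendsto_const)

lemma op_fun_cong:
  assumes pos: "positive_op A" and "\<And>t. 0 \<le> t \<Longrightarrow> f t = g t"
  shows "op_fun f A = op_fun g A"
proof -
  have "uniform_limit (real_spectrum A) P f sequentially = uniform_limit (real_spectrum A) P g sequentially" for P
    using positive_imp_spectrum_subset[OF pos] assms(2) by (intro uniform_limit_cong') auto
  then show ?thesis by (simp add: op_fun_def)
qed

lemma op_fun_add:
  assumes pos: "positive_op A" and f: "continuous_on {0..} f" and g: "continuous_on {0..} g"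
  shows "op_fun (\<lambda>t. f t + g t) A = op_fun f A + op_fun g A"
proof -
  obtain p q where p: "uniform_limit {0..norm A} (\<lambda>n. poly (p n)) f sequentially"
    and q: "uniform_limit {0..norm A} (\<lambda>n. poly (q n)) g sequentially"
    using poly_uniform_approximation f g by metis
  have "uniform_limit {0..norm A} (\<lambda>n. poly (p n + q n)) (\<lambda>t. f t + g t) sequentially"
    using uniform_limit_add[OF p q] by (simp cong: uniform_limit_cong')
  then have "(\<lambda>n. op_poly (p n + q n) A) \<longlonglongrightarrow> op_fun (\<lambda>t. f t + g t) A"
    using pos f g by (intro op_fun_tendsto_interval continuous_on_add) auto
  moreover have "(\<lambda>n. op_poly (p n + q n) A) \<longlonglongrightarrow> op_fun f A + op_fun g A"
    unfolding op_poly_add using pos f g p q by (intro tendsto_add op_fun_tendsto_interval) auto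
  ultimately show ?thesis by (rule LIMSEQ_unique)
qed

lemma op_fun_mult:
  assumes pos: "positive_op A" and f: "continuous_on {0..} f" and g: "continuous_on {0..} g"
  shows "op_fun (\<lambda>t. f t * g t) A = op_fun f A o\<^sub>L op_fun g A"
proof -
  obtain p q where p: "uniform_limit {0..norm A} (\<lambda>n. poly (p n)) f sequentially"
    and q: "uniform_limit {0..norm A} (\<lambda>n. poly (q n)) g sequentially"
    using poly_uniform_approximation f g by metis
  have bdd: "bounded (h ` {0..norm A})" if "continuous_on {0..} h" for h :: "real \<Rightarrow> real"
    by (intro compact_imp_bounded compact_continuous_image continuous_on_subset[OF that]) auto
  have "uniform_limit {0..norm A} (\<lambda>n. poly (p n * q n)) (\<lambda>t. f t * g t) sequentially"
    using uniform_lim_mult[OF p q bdd[OF f] bdd[OF g]] by (simp cong: uniform_limit_cong')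
  then have "(\<lambda>n. op_poly (p n * q n) A) \<longlonglongrightarrow> op_fun (\<lambda>t. f t * g t) A"
    using pos f g by (intro op_fun_tendsto_interval continuous_on_mult) auto
  moreover have "(\<lambda>n. op_poly (p n * q n) A) \<longlonglongrightarrow> (op_fun f A o\<^sub>L op_fun g A)"
    unfolding op_poly_mult using pos f g p q
    by (intro bounded_bilinear.tendsto[OF bounded_bilinear_blinfun_compose] op_fun_tendsto_interval) auto
  ultimately show ?thesis by (rule LIMSEQ_unique)
qed

lemma op_fun_intertwine:
  assumes "positive_op A" "positive_op B" and f: "continuous_on {0..} f"
    and TA: "T o\<^sub>L A = B o\<^sub>L T"
  shows "T o\<^sub>L op_fun f A = op_fun f B o\<^sub>L T"
proof -
  obtain p where p: "uniform_limit {0..max (norm A) (norm B)} (\<lambda>n. poly (p n)) f sequentially"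
    using poly_uniform_approximation[OF f] .
  have "(\<lambda>n. T o\<^sub>L op_poly (p n) A) \<longlonglongrightarrow> (T o\<^sub>L op_fun f A)"
    using assms p by (intro bounded_bilinear.tendsto[OF bounded_bilinear_blinfun_compose]
        tendsto_const op_fun_tendsto_interval) auto
  moreover have "(\<lambda>n. op_poly (p n) B o\<^sub>L T) \<longlonglongrightarrow> (op_fun f B o\<^sub>L T)"
    using assms p by (intro bounded_bilinear.tendsto[OF bounded_bilinear_blinfun_compose]
        tendsto_const op_fun_tendsto_interval) auto
  ultimately show ?thesis unfolding op_poly_intertwine[OF TA] by (rule LIMSEQ_unique)
qed

lemma self_adjoint_limit:
  assumes A: "\<And>n. self_adjoint (A n)" and lim: "A \<longlonglongrightarrow> L"
  shows "self_adjoint L"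
proof -
  have app: "(\<lambda>n. blinfun_apply (A n) x) \<longlonglongrightarrow> blinfun_apply L x" for x
    by (intro blinfun.tendsto lim tendsto_const)
  have "blinfun_apply L (c *\<^sub>C x) = c *\<^sub>C blinfun_apply L x" for c x
  proof (rule LIMSEQ_unique[OF app])
    show "(\<lambda>n. blinfun_apply (A n) (c *\<^sub>C x)) \<longlonglongrightarrow> c *\<^sub>C blinfun_apply L x"
      using bounded_linear.tendsto[OF bounded_linear_scaleC app[of x], of c] A
      by (simp add: self_adjoint_def complex_linear_def)
  qed
  moreover have "rinner (blinfun_apply L x) y = rinner x (blinfun_apply L y)" for x y
  proof (rule LIMSEQ_unique)
    show "(\<lambda>n. rinner (blinfun_apply (A n) x) y) \<longlonglongrightarrow> rinner (blinfun_apply L x) y"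
      by (intro rinner.tendsto app tendsto_const)
    show "(\<lambda>n. rinner (blinfun_apply (A n) x) y) \<longlonglongrightarrow> rinner x (blinfun_apply L y)"
      unfolding rinner_self_adjoint[OF A] by (intro rinner.tendsto app tendsto_const)
  qed
  ultimately show ?thesis by (simp add: self_adjoint_def complex_linear_def)
qed

lemma self_adjoint_op_fun:
  assumes "positive_op A" "continuous_on {0..} f"
  shows "self_adjoint (op_fun f A)"
proof -
  obtain p where "uniform_limit {0..norm A} (\<lambda>n. poly (p n)) f sequentially"
    using poly_uniform_approximation[OF assms(2)] .
  then have "(\<lambda>n. op_poly (p n) A) \<longlonglongrightarrow> op_fun f A"
    using assms by (intro op_fun_tendsto_interval) auto
  then show ?thesis
    by (rule self_adjoint_limit[rotated]) (use assms in \<open>auto simp: positive_op_def intro: self_adjoint_op_poly\<close>)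
qed

lemma rinner_op_fun_mult:
  assumes "positive_op A" "continuous_on {0..} f" "continuous_on {0..} g"
  shows "rinner (blinfun_apply (op_fun (\<lambda>t. f t * g t) A) x) y
    = rinner (blinfun_apply (op_fun g A) x) (blinfun_apply (op_fun f A) y)"
  using assms by (simp add: op_fun_mult rinner_self_adjoint self_adjoint_op_fun)

text \<open>A nonnegative \<open>f\<close> is the square of \<open>sqrt \<circ> f\<close>, so that \<open>f(A)\<close> is the square of a
self-adjoint operator.\<close>

lemma positive_op_fun:
  assumes "positive_op A" and f: "continuous_on {0..} f" and nn: "\<And>t. 0 \<le> t \<Longrightarrow> 0 \<le> f t"
  shows "positive_op (op_fun f A)"
proof -
  have s: "continuous_on {0..} (\<lambda>t. sqrt (f t))" by (intro continuous_on_real_sqrt f)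
  have "op_fun f A = op_fun (\<lambda>t. sqrt (f t) * sqrt (f t)) A"
    using assms by (intro op_fun_cong) auto
  then have "rinner (blinfun_apply (op_fun f A) x) x = (norm (blinfun_apply (op_fun (\<lambda>t. sqrt (f t)) A) x))\<^sup>2" for x
    using rinner_op_fun_mult[OF assms(1) s s] by (simp add: rinner_self)
  then show ?thesis using self_adjoint_op_fun[OF assms(1) f] by (simp add: positive_op_def)
qed

lemma rinner_op_fun_mono:
  assumes pos: "positive_op A" and f: "continuous_on {0..} f" and g: "continuous_on {0..} g"
    and le: "\<And>t. 0 \<le> t \<Longrightarrow> f t \<le> g t"
  shows "rinner (blinfun_apply (op_fun f A) x) x \<le> rinner (blinfun_apply (op_fun g A) x) x"
proof -
  have d: "continuous_on {0..} (\<lambda>t. g t - f t)" by (intro continuous_on_diff f g)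
  have "op_fun g A = op_fun f A + op_fun (\<lambda>t. g t - f t) A"
    using op_fun_add[OF pos f d] by simp
  moreover have "0 \<le> rinner (blinfun_apply (op_fun (\<lambda>t. g t - f t) A) x) x"
    using positive_op_fun[OF pos d] le by (simp add: positive_op_def)
  ultimately show ?thesis by (simp add: blinfun.add_left rinner.add_left)
qed

section \<open>The mixed Schwarz inequality\<close>

abbreviation real_power :: "real \<Rightarrow> real \<Rightarrow> real" where
  "real_power s \<equiv> (\<lambda>t. if s = 0 then 1 else t powr s)"

lemma continuous_on_real_power: "0 \<le> s \<Longrightarrow> continuous_on {0..} (real_power s)"
proof (cases "s = 0")
  case False
  assume "0 \<le> s"
  then have "continuous_on {0..} (\<lambda>t::real. t powr s)"
    using False by (intro continuous_on_powr' continuous_intros) auto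
  then show ?thesis using False by simp
qed simp

lemma positive_adjoint_compose:
  assumes "complex_linear T"
  shows "positive_op (op_adjoint T o\<^sub>L T)"
proof -
  have "rinner (blinfun_apply (op_adjoint T) (blinfun_apply T x)) y
      = rinner (blinfun_apply T x) (blinfun_apply T y)" for x y
    using rinner_adjoint[OF assms, of y "blinfun_apply T x"] by (simp add: rinner_commute)
  moreover have "rinner x (blinfun_apply (op_adjoint T) (blinfun_apply T y))
      = rinner (blinfun_apply T x) (blinfun_apply T y)" for x y
    using rinner_adjoint[OF assms] by simp
  ultimately show ?thesis
    using assms by (simp add: positive_op_def self_adjoint_def rinner_self complex_linear_compose complex_linear_adjoint)
qed

lemma positive_op_abs:
  assumes "complex_linear T" shows "positive_op (op_abs T)"
  unfolding op_abs_def op_powr_def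
  by (intro positive_op_fun positive_adjoint_compose assms continuous_on_real_power) auto

lemma op_abs_square:
  assumes "complex_linear T" shows "op_abs T o\<^sub>L op_abs T = op_adjoint T o\<^sub>L T"
proof -
  let ?N = "op_adjoint T o\<^sub>L T"
  have pos: "positive_op ?N" by (rule positive_adjoint_compose[OF assms])
  have "op_abs T o\<^sub>L op_abs T = op_fun (\<lambda>t. real_power (1/2) t * real_power (1/2) t) ?N"
    unfolding op_abs_def op_powr_def
    by (intro op_fun_mult[symmetric] pos continuous_on_real_power) auto
  also have "\<dots> = op_fun (poly [:0, 1:]) ?N"
    by (rule op_fun_cong[OF pos]) (simp add: powr_add[symmetric])
  also have "\<dots> = ?N"
    unfolding op_fun_poly[OF pos] by (simp add: op_poly_pCons op_poly_0 compose_simps)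
  finally show ?thesis .
qed

text \<open>The identity \<open>T |T| = |T\<^sup>*| T\<close> follows from \<open>T (T\<^sup>*T) = (TT\<^sup>*) T\<close>, and it passes on to
\<open>T h(|T|) = h(|T\<^sup>*|) T\<close> for continuous \<open>h\<close>. It takes the place of the polar decomposition.\<close>

lemma op_abs_intertwine:
  assumes "complex_linear T"
  shows "T o\<^sub>L op_abs T = op_abs (op_adjoint T) o\<^sub>L T"
  unfolding op_abs_def op_powr_def
  by (intro op_fun_intertwine positive_adjoint_compose complex_linear_adjoint assms continuous_on_real_power)
    (simp_all add: adjoint_adjoint[OF assms] blinfun_compose_assoc)

text \<open>Kato's mixed Schwarz inequality in additive form. Write \<open>P = |T|\<close>, \<open>Q = |T\<^sup>*|\<close>, and let \<open>f\<close> and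
\<open>g\<close> be the powers with exponents \<open>2\<alpha>\<close> and \<open>2(1-\<alpha>)\<close>, so that \<open>f(t) g(t) = t\<^sup>2\<close>. Formally, for
\<open>h = sqrt f\<close> and \<open>k = 1 / h\<close>, the number \<open>\<langle>Tu, v\<rangle>\<close> is the inner product of \<open>h(P) u\<close> and
\<open>k(P) T\<^sup>*v\<close>. The squared norm of the former is \<open>\<langle>f(P) u, u\<rangle>\<close>; that of the latter is
\<open>\<langle>T k\<^sup>2(P) T\<^sup>*v, v\<rangle> = \<langle>k\<^sup>2(Q) Q\<^sup>2 v, v\<rangle> = \<langle>g(Q) v, v\<rangle>\<close> by intertwining. Since \<open>f\<close> may vanish at
\<open>0\<close>, the proof takes \<open>h = sqrt (f + d)\<close> with \<open>d > 0\<close>. This costs only \<open>d \<parallel>u\<parallel>\<^sup>2\<close>, as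
\<open>t\<^sup>2 / (f(t) + d) \<le> g(t)\<close>; finally \<open>d\<close> tends to \<open>0\<close>.\<close>

lemma mixed_Schwarz:
  assumes T: "complex_linear T" and "0 \<le> \<alpha>" "\<alpha> \<le> 1"
  shows "2 * rinner (blinfun_apply T u) v
    \<le> rinner (blinfun_apply (op_powr (op_abs T) (2 * \<alpha>)) u) u
      + rinner (blinfun_apply (op_powr (op_abs (op_adjoint T)) (2 * (1 - \<alpha>))) v) v"
proof -
  define P where "P = op_abs T"
  define Q where "Q = op_abs (op_adjoint T)"
  have P: "positive_op P" and Q: "positive_op Q"
    using T by (auto simp: P_def Q_def intro: positive_op_abs complex_linear_adjoint)
  define f where "f = real_power (2 * \<alpha>)"
  define g where "g = real_power (2 * (1 - \<alpha>))"
  have f: "continuous_on {0..} f" and g: "continuous_on {0..} g"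
    unfolding f_def g_def by (intro continuous_on_real_power; use assms in simp)+
  have f_nn: "0 \<le> f t" for t by (simp add: f_def)
  have fg: "f t * g t = t\<^sup>2" if "0 \<le> t" for t
  proof (cases "t = 0")
    case False
    then have "t powr 2 = t\<^sup>2" using that by simp
    then show ?thesis
      by (auto simp: f_def g_def powr_add[symmetric] algebra_simps)
  qed (auto simp: f_def g_def)
  have main: "2 * rinner (blinfun_apply T u) v
    \<le> rinner (blinfun_apply (op_fun f P) u) u + rinner (blinfun_apply (op_fun g Q) v) v + d * (norm u)\<^sup>2"
    if "0 < d" for d
  proof -
    define h where "h t = sqrt (f t + d)" for t
    define k where "k t = 1 / h t" for t
    have h_pos: "0 < h t" for t using f_nn[of t] \<open>0 < d\<close> by (simp add: h_def)
    have h: "continuous_on {0..} h"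
      unfolding h_def by (intro continuous_intros f)
    have k: "continuous_on {0..} k"
      unfolding k_def using h_pos by (intro continuous_intros h) (auto simp: less_imp_neq[symmetric])
    have sq: "continuous_on {0..} (\<lambda>t::real. t\<^sup>2)" by (intro continuous_intros)
    have one: "op_fun (\<lambda>t. k t * h t) P = id_blinfun"
    proof -
      have "op_fun (\<lambda>t. k t * h t) P = op_fun (poly 1) P"
        by (rule op_fun_cong[OF P]) (use h_pos in \<open>auto simp: k_def less_imp_neq[symmetric]\<close>)
      then show ?thesis by (simp only: op_fun_poly[OF P] op_poly_1)
    qed
    have "rinner (blinfun_apply T u) v = rinner u (blinfun_apply (op_adjoint T) v)"
      by (rule rinner_adjoint[OF T])
    also have "\<dots> = rinner (blinfun_apply (op_fun h P) u) (blinfun_apply (op_fun k P) (blinfun_apply (op_adjoint T) v))"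
      using rinner_op_fun_mult[OF P k h] by (simp add: one)
    also have "2 * \<dots> \<le> (norm (blinfun_apply (op_fun h P) u))\<^sup>2
        + (norm (blinfun_apply (op_fun k P) (blinfun_apply (op_adjoint T) v)))\<^sup>2"
      using norm_diff_sq[of "blinfun_apply (op_fun h P) u"] zero_le_power2 by (smt (verit))
    also have "(norm (blinfun_apply (op_fun h P) u))\<^sup>2 = rinner (blinfun_apply (op_fun f P) u) u + d * (norm u)\<^sup>2"
    proof -
      have "(norm (blinfun_apply (op_fun h P) u))\<^sup>2 = rinner (blinfun_apply (op_fun (\<lambda>t. h t * h t) P) u) u"
        by (simp add: rinner_op_fun_mult[OF P h h] rinner_self)
      also have "op_fun (\<lambda>t. h t * h t) P = op_fun (\<lambda>t. f t + poly [:d:] t) P"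
        by (rule op_fun_cong[OF P]) (use f_nn \<open>0 < d\<close> in \<open>simp add: h_def\<close>)
      also have "\<dots> = op_fun f P + d *\<^sub>R id_blinfun"
        unfolding op_fun_add[OF P f continuous_on_poly[OF continuous_on_id]] op_fun_poly[OF P]
        by (simp add: op_poly_pCons op_poly_0 compose_simps)
      finally show ?thesis
        by (simp add: blinfun.bilinear_simps rinner.add_left rinner_scaleR_left rinner_self)
    qed
    also have "(norm (blinfun_apply (op_fun k P) (blinfun_apply (op_adjoint T) v)))\<^sup>2
        \<le> rinner (blinfun_apply (op_fun g Q) v) v"
    proof -
      let ?k2 = "\<lambda>t. k t * k t"
      have k2: "continuous_on {0..} ?k2" by (intro continuous_intros k)
      have TP: "T o\<^sub>L op_fun ?k2 P = op_fun ?k2 Q o\<^sub>L T"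
        using op_abs_intertwine[OF T] by (intro op_fun_intertwine P Q k2) (simp add: P_def Q_def)
      have QQ: "op_fun (\<lambda>t. t\<^sup>2) Q = T o\<^sub>L op_adjoint T"
      proof -
        have "op_fun (\<lambda>t. t\<^sup>2) Q = op_fun (poly [:0, 0, 1:]) Q"
          by (rule op_fun_cong[OF Q]) (simp add: power2_eq_square)
        also have "\<dots> = Q o\<^sub>L Q" by (simp only: op_fun_poly[OF Q]) (simp add: op_poly_pCons op_poly_0 compose_simps)
        also have "\<dots> = T o\<^sub>L op_adjoint T"
          unfolding Q_def using op_abs_square[OF complex_linear_adjoint[OF T]] by (simp add: adjoint_adjoint[OF T])
        finally show ?thesis .
      qed
      let ?w = "blinfun_apply (op_adjoint T) v"
      have "(norm (blinfun_apply (op_fun k P) ?w))\<^sup>2 = rinner (blinfun_apply (op_fun ?k2 P) ?w) ?w"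
        by (simp add: rinner_op_fun_mult[OF P k k] rinner_self)
      also have "\<dots> = rinner (blinfun_apply (T o\<^sub>L op_fun ?k2 P) ?w) v"
        by (simp add: rinner_adjoint[OF T])
      also have "\<dots> = rinner (blinfun_apply (op_fun (\<lambda>t. ?k2 t * t\<^sup>2) Q) v) v"
        unfolding TP op_fun_mult[OF Q k2 sq] QQ by simp
      also have "\<dots> \<le> rinner (blinfun_apply (op_fun g Q) v) v"
      proof (rule rinner_op_fun_mono[OF Q _ g])
        fix t :: real assume "0 \<le> t"
        have g_nn: "0 \<le> g t" by (simp add: g_def)
        have "?k2 t * t\<^sup>2 = f t * g t / (f t + d)"
          using f_nn[of t] \<open>0 < d\<close> fg[OF \<open>0 \<le> t\<close>] by (simp add: k_def h_def)
        also have "\<dots> \<le> g t"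
          using f_nn[of t] \<open>0 < d\<close> g_nn by (simp add: divide_le_eq algebra_simps)
        finally show "?k2 t * t\<^sup>2 \<le> g t" .
      qed (intro continuous_on_mult k2 sq)
      finally show ?thesis .
    qed
    finally show ?thesis by simp
  qed
  have "2 * rinner (blinfun_apply T u) v
    \<le> rinner (blinfun_apply (op_fun f P) u) u + rinner (blinfun_apply (op_fun g Q) v) v"
  proof (rule field_le_epsilon)
    fix e :: real assume "0 < e"
    then have "0 < e / ((norm u)\<^sup>2 + 1)" by (simp add: add_nonneg_pos)
    moreover have "e / ((norm u)\<^sup>2 + 1) * (norm u)\<^sup>2 \<le> e"
      using \<open>0 < e\<close> by (simp add: divide_le_eq add_nonneg_pos)
    ultimately show "2 * rinner (blinfun_apply T u) v
      \<le> rinner (blinfun_apply (op_fun f P) u) u + rinner (blinfun_apply (op_fun g Q) v) v + e"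
      using main[of "e / ((norm u)\<^sup>2 + 1)"] by linarith
  qed
  then show ?thesis by (simp only: op_powr_def P_def Q_def f_def g_def)
qed

section \<open>The bound for the q-numerical radius\<close>

lemma rinner_le_norm_blinfun:
  assumes "norm x = 1" shows "rinner (blinfun_apply G x) x \<le> norm G"
  using rinner_le_norm_mult[of "blinfun_apply G x" x] norm_blinfun[of G x] assms by simp

text \<open>Rotating \<open>y\<close> by the phase of the inner product turns a modulus into a real inner product.\<close>

lemma cmod_cinner_eq_rinner:
  obtains y' where "norm y' = norm y" "cmod (cinner x y) = rinner x y'"
proof (cases "cinner x y = 0")
  case True
  then show ?thesis using that[of y] by (simp add: rinner_def)
next
  case False
  define z where "z = cinner x y"
  have "cinner x (sgn z *\<^sub>C y) = z * cnj z / complex_of_real (cmod z)"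
    by (simp add: cinner_scaleC_right z_def[symmetric] sgn_eq)
  also have "\<dots> = complex_of_real (cmod z)"
    using False unfolding complex_norm_square[symmetric] by (simp add: z_def power2_eq_square)
  finally have "cinner x (sgn z *\<^sub>C y) = complex_of_real (cmod z)" .
  moreover have "norm (sgn z *\<^sub>C y) = norm y"
    using False by (simp add: norm_scaleC norm_sgn z_def)
  ultimately show ?thesis using that[of "sgn z *\<^sub>C y"] by (simp add: rinner_def z_def)
qed

theorem theorem2p17:
  fixes A B C D S T :: "'a::complex_hilbert \<Rightarrow>\<^sub>L 'a" and q \<alpha> :: real
  assumes "complex_linear A" and "complex_linear B" and "complex_linear C"
    and "complex_linear D" and "complex_linear S" and "complex_linear T"
    and "0 \<le> q" and "q \<le> 1"
    and "0 \<le> \<alpha>" and "\<alpha> \<le> 1"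
  shows "q_numerical_radius q ((A o\<^sub>L T o\<^sub>L B) + (C o\<^sub>L S o\<^sub>L D)) \<le>
    1/2 * (norm ((A o\<^sub>L op_powr (op_abs (op_adjoint T)) (2 * (1 - \<alpha>)) o\<^sub>L op_adjoint A)
               + (C o\<^sub>L op_powr (op_abs (op_adjoint S)) (2 * (1 - \<alpha>)) o\<^sub>L op_adjoint C))
         + norm ((op_adjoint B o\<^sub>L op_powr (op_abs T) (2 * \<alpha>) o\<^sub>L B)
               + (op_adjoint D o\<^sub>L op_powr (op_abs S) (2 * \<alpha>) o\<^sub>L D)))"
    (is "_ \<le> 1/2 * (norm ?M + norm ?N)")
proof -
  let ?R = "(A o\<^sub>L T o\<^sub>L B) + (C o\<^sub>L S o\<^sub>L D)"
  have bound: "cmod (cinner (blinfun_apply ?R x) y) \<le> 1/2 * (norm ?M + norm ?N)"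
    if "norm x = 1" "norm y = 1" for x y
  proof -
    obtain y' where y': "norm y' = norm y" "cmod (cinner (blinfun_apply ?R x) y) = rinner (blinfun_apply ?R x) y'"
      by (rule cmod_cinner_eq_rinner)
    have adj_left: "rinner (blinfun_apply (op_adjoint F) a) b = rinner a (blinfun_apply F b)"
      if "complex_linear F" for F :: "'a \<Rightarrow>\<^sub>L 'a" and a b
      by (metis that rinner_adjoint rinner_commute)
    have "2 * rinner (blinfun_apply ?R x) y'
        = 2 * rinner (blinfun_apply T (blinfun_apply B x)) (blinfun_apply (op_adjoint A) y')
        + 2 * rinner (blinfun_apply S (blinfun_apply D x)) (blinfun_apply (op_adjoint C) y')"
      using assms by (simp add: blinfun.add_left rinner.add_left rinner_adjoint)
    also have "\<dots> \<le> rinner (blinfun_apply ?N x) x + rinner (blinfun_apply ?M y') y'"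
      using mixed_Schwarz[OF assms(6,9,10), of "blinfun_apply B x" "blinfun_apply (op_adjoint A) y'"]
        mixed_Schwarz[OF assms(5,9,10), of "blinfun_apply D x" "blinfun_apply (op_adjoint C) y'"]
      by (simp add: blinfun.add_left rinner.add_left rinner_adjoint[OF assms(1)]
          rinner_adjoint[OF assms(3)] adj_left[OF assms(2)] adj_left[OF assms(4)])
    also have "\<dots> \<le> norm ?N + norm ?M"
      using that y' by (intro add_mono rinner_le_norm_blinfun) auto
    finally show ?thesis using y' by simp
  qed
  show ?thesis
    unfolding q_numerical_radius_def Let_def
  proof (split if_split, intro conjI impI)
    show "0 \<le> 1/2 * (norm ?M + norm ?N)" by simp
  next
    assume "{cmod (cinner (blinfun_apply ?R x) y) | x y.
        norm x = 1 \<and> norm y = 1 \<and> cinner x y = complex_of_real q} \<noteq> {}"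
    then show "Sup {cmod (cinner (blinfun_apply ?R x) y) | x y.
        norm x = 1 \<and> norm y = 1 \<and> cinner x y = complex_of_real q} \<le> 1/2 * (norm ?M + norm ?N)"
      by (rule cSup_least) (use bound in blast)
  qed
qed

end
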